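(* Let $G$ be an unweighted simple graph. If $L(G)$ is diagonalisable by a (real) Hadamard matrix or a Turyn Hadamard matrix, then $$h_G=\frac{\gamma_2}{2}.$$
   Context: A complex Hadamard matrix of order $n$ is an $n\times n$ complex matrix $H$ whose entries all have modulus one and which satisfies $HH^*=nI$. It is a (real) Hadamard matrix if all entries are $\pm1$, and a Turyn Hadamard matrix if all entries lie in $\{1,-1,\mathrm i,-\mathrm i\}$. $L(G)=D(G)-A(G)$ is the Laplacian, where $A(G)$ is the adjacency matrix and $D(G)$ the diagonal matrix of vertex degrees; it is diagonalisable by $H$ if every column of $H$ is an eigenvector of $L(G)$; then $G$ is necessarily $d$-regular for some $d$. $\gamma_2$ is the second smallest eigenvalue (counted with multiplicity) of the normalised Laplacian $\mathcal L(G)$, which for a $d$-regular graph equals $\frac1d L(G)$. For a set $S$ of vertices of $G$, $$h_G(S)=\frac{|E(S,V(G)-S)|}{\min\left(\sum_{x\in S}\deg(x),\sum_{y\notin S}\deg(y)\right)},$$ where $|E(S,V(G)-S)|$ is the number of edges with exactly one endpoint in $S$. The Cheeger constant of $G$ is $h_G=\min_{S} h_G(S)$ over non-empty proper subsets $S\subset V(G)$. *)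

theory Defs
  imports
    "Graph_Theory.Pair_Digraph"
    "Jordan_Normal_Form.Char_Poly"
    "Jordan_Normal_Form.Schur_Decomposition"
    "HOL-Computational_Algebra.Fundamental_Theorem_Algebra"
begin

text \<open>
  A finite simple graph is a \<^locale>\<open>pair_graph\<close>: an undirected edge \<open>uv\<close> is the pair of opposite
  arcs \<open>(u,v)\<close> and \<open>(v,u)\<close>, so the degree of a vertex is its out-degree. The matrices of a graph
  are taken with respect to an enumeration \<open>vs\<close> of its vertices (a distinct list of all of them).
\<close>

definition vertex_enumeration :: "'v pair_pre_digraph \<Rightarrow> 'v list \<Rightarrow> bool" where
  "vertex_enumeration G vs \<longleftrightarrow> distinct vs \<and> set vs = pverts G"

definition degree_of :: "'v pair_pre_digraph \<Rightarrow> 'v \<Rightarrow> nat" where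
  "degree_of G x = out_degree (with_proj G) x"

definition adjacency_mat :: "'v pair_pre_digraph \<Rightarrow> 'v list \<Rightarrow> real mat" where
  "adjacency_mat G vs = mat (length vs) (length vs)
     (\<lambda>(i, j). if (vs ! i, vs ! j) \<in> parcs G then 1 else 0)"

definition degree_mat :: "'v pair_pre_digraph \<Rightarrow> 'v list \<Rightarrow> real mat" where
  "degree_mat G vs = mat (length vs) (length vs)
     (\<lambda>(i, j). if i = j then real (degree_of G (vs ! i)) else 0)"

definition laplacian_mat :: "'v pair_pre_digraph \<Rightarrow> 'v list \<Rightarrow> real mat" where
  "laplacian_mat G vs = degree_mat G vs - adjacency_mat G vs"

text \<open>
  The normalised Laplacian \<open>D\<^sup>-\<^sup>1\<^sup>/\<^sup>2 L D\<^sup>-\<^sup>1\<^sup>/\<^sup>2\<close>. Because \<open>x / 0 = 0\<close>, rows and columns of isolated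
  vertices are zero, which is the usual convention.
\<close>

definition normalised_laplacian_mat :: "'v pair_pre_digraph \<Rightarrow> 'v list \<Rightarrow> real mat" where
  "normalised_laplacian_mat G vs = mat (length vs) (length vs)
     (\<lambda>(i, j). laplacian_mat G vs $$ (i, j) /
        (sqrt (real (degree_of G (vs ! i))) * sqrt (real (degree_of G (vs ! j)))))"

text \<open>
  The list below has all the eigenvalues of a real symmetric matrix, since its characteristic
  polynomial splits over the reals; position 1 (counting from 0) holds the second smallest.
\<close>

definition sorted_eigenvalues :: "real mat \<Rightarrow> real list" where
  "sorted_eigenvalues A = sorted_list_of_multiset (proots (char_poly A))"

definition gamma2 :: "'v pair_pre_digraph \<Rightarrow> 'v list \<Rightarrow> real" where
  "gamma2 G vs = sorted_eigenvalues (normalised_laplacian_mat G vs) ! 1"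

definition complex_hadamard :: "nat \<Rightarrow> complex mat \<Rightarrow> bool" where
  "complex_hadamard n H \<longleftrightarrow> H \<in> carrier_mat n n \<and>
     (\<forall>i<n. \<forall>j<n. cmod (H $$ (i, j)) = 1) \<and>
     H * mat_adjoint H = of_nat n \<cdot>\<^sub>m 1\<^sub>m n"

definition real_hadamard :: "nat \<Rightarrow> complex mat \<Rightarrow> bool" where
  "real_hadamard n H \<longleftrightarrow> complex_hadamard n H \<and>
     (\<forall>i<n. \<forall>j<n. H $$ (i, j) \<in> {1, -1})"

definition turyn_hadamard :: "nat \<Rightarrow> complex mat \<Rightarrow> bool" where
  "turyn_hadamard n H \<longleftrightarrow> complex_hadamard n H \<and>
     (\<forall>i<n. \<forall>j<n. H $$ (i, j) \<in> {1, -1, \<i>, -\<i>})"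

definition laplacian_diagonalisable_by ::
    "'v pair_pre_digraph \<Rightarrow> 'v list \<Rightarrow> complex mat \<Rightarrow> bool" where
  "laplacian_diagonalisable_by G vs H \<longleftrightarrow>
     (\<forall>j<dim_col H. \<exists>k. eigenvector (map_mat complex_of_real (laplacian_mat G vs)) (col H j) k)"

text \<open>
  Every edge with exactly one endpoint in \<open>S\<close> contributes exactly one arc leaving \<open>S\<close>.
\<close>

definition edge_boundary :: "'v pair_pre_digraph \<Rightarrow> 'v set \<Rightarrow> ('v \<times> 'v) set" where
  "edge_boundary G S = {e \<in> parcs G. fst e \<in> S \<and> snd e \<in> pverts G - S}"

text \<open>
  For sets with zero volume on one side the quotient is \<open>0 / 0\<close>, hence 0. In a regular graph this
  happens only if there are no edges.
\<close>

definition cheeger_ratio :: "'v pair_pre_digraph \<Rightarrow> 'v set \<Rightarrow> real" where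
  "cheeger_ratio G S = real (card (edge_boundary G S)) /
     real (min (\<Sum>x\<in>S. degree_of G x) (\<Sum>y\<in>pverts G - S. degree_of G y))"

definition cheeger_constant :: "'v pair_pre_digraph \<Rightarrow> real" where
  "cheeger_constant G = Min (cheeger_ratio G ` {S. S \<subset> pverts G \<and> S \<noteq> {}})"

end

theory Submission
  imports Defs
begin

text \<open>
  Write \<open>L = H diag(\<kappa>) H\<^sup>* / n\<close>. Since the entries of \<open>H\<close> are unimodular, the diagonal of \<open>L\<close> is
  constant, so \<open>G\<close> is \<open>d\<close>-regular, and both sides can be compared for \<open>L\<close> before dividing by \<open>d\<close>.
  The Rayleigh quotient of a centred indicator function gives \<open>h(S) \<ge> \<gamma>\<^sub>2 / 2\<close> for every \<open>S\<close>.
  Conversely, a column of \<open>H\<close> with the second smallest eigenvalue yields a non-constant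
  eigenvector with entries \<open>\<plusminus>1\<close>. It is orthogonal to the constants if the eigenvalue is positive,
  so that its level sets are halves of \<open>V(G)\<close> attaining the bound; if the eigenvalue is 0, no
  edge joins its level sets.
\<close>

subsection \<open>Laplacians diagonalised by a Hadamard matrix\<close>

text \<open>Expanding \<open>|x i - x k|^2\<close> under the double sum gives two diagonal and two
  mixed sums, equal in pairs by the symmetry of \<open>W\<close>. This is the Dirichlet form of the
  weighted Laplacian; the division by 2 accounts for ordered pairs.\<close>

lemma sum_Laplacian_form:
  fixes W :: "nat \<Rightarrow> nat \<Rightarrow> real" and x :: "nat \<Rightarrow> complex"
  assumes sym: "\<And>i k. i < n \<Longrightarrow> k < n \<Longrightarrow> W i k = W k i"
  shows "(\<Sum>i<n. cnj (x i) * (of_real (\<Sum>k<n. W i k) * x i - (\<Sum>k<n. of_real (W i k) * x k)))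
       = of_real ((\<Sum>i<n. \<Sum>k<n. W i k * (cmod (x i - x k))\<^sup>2) / 2)"
proof -
  define P where "P = (\<Sum>i<n. \<Sum>k<n. of_real (W i k) * (x i * cnj (x i)))"
  define Q where "Q = (\<Sum>i<n. \<Sum>k<n. of_real (W i k) * (cnj (x i) * x k))"
  have P': "(\<Sum>i<n. \<Sum>k<n. of_real (W i k) * (x k * cnj (x k))) = P"
    unfolding P_def by (subst sum.swap) (intro sum.cong refl, simp add: sym)
  have Q': "(\<Sum>i<n. \<Sum>k<n. of_real (W i k) * (x i * cnj (x k))) = Q"
    unfolding Q_def by (subst sum.swap) (intro sum.cong refl, simp add: sym mult.commute)
  have sq: "complex_of_real (W i k * (cmod (x i - x k))\<^sup>2)
      = of_real (W i k) * (x i * cnj (x i)) + of_real (W i k) * (x k * cnj (x k))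
      - of_real (W i k) * (cnj (x i) * x k) - of_real (W i k) * (x i * cnj (x k))" for i k
    unfolding of_real_mult complex_norm_square by (simp add: algebra_simps)
  have "(\<Sum>i<n. cnj (x i) * (of_real (\<Sum>k<n. W i k) * x i - (\<Sum>k<n. of_real (W i k) * x k))) = P - Q"
    by (simp add: P_def Q_def sum_subtractf sum_distrib_left sum_distrib_right right_diff_distrib ac_simps)
  moreover have "of_real (\<Sum>i<n. \<Sum>k<n. W i k * (cmod (x i - x k))\<^sup>2) = P + P - Q - Q"
    unfolding of_real_sum sq sum.distrib sum_subtractf P' Q' by (simp add: P_def Q_def)
  ultimately show ?thesis by simp
qed

text \<open>Sorting the indices by \<open>f\<close>, rather than the values, makes \<open>p\<close>
  and \<open>q\<close> distinct and so counts eigenvalues with multiplicity. The factor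
  \<open>c\<close> will be \<open>1 / d\<close>, which is 0 for a graph without edges.\<close>

lemma second_smallest:
  fixes f :: "nat \<Rightarrow> real"
  assumes "2 \<le> n"
  obtains p q where "p < n" "q < n" "p \<noteq> q" "f p \<le> f q"
    "\<And>j. j < n \<Longrightarrow> j \<noteq> p \<Longrightarrow> f q \<le> f j"
    "\<And>c. 0 \<le> c \<Longrightarrow> sorted_list_of_multiset (mset (map (\<lambda>j. c * f j) [0..<n])) ! 1 = c * f q"
proof -
  define js where "js = sort_key f [0..<n]"
  have set: "set js = {..<n}" and dist: "distinct js" and len: "length js = n"
    and srt: "sorted (map f js)"
    by (auto simp: js_def)
  have mono: "f (js ! a) \<le> f (js ! b)" if "a \<le> b" "b < n" for a b
    using sorted_nth_mono[OF srt that(1)] that len by simp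
  have lt: "js ! a < n" if "a < n" for a
    using nth_mem[of a js] that set len by auto
  show ?thesis
  proof (rule that[of "js ! 0" "js ! 1"])
    show "js ! 0 < n" "js ! 1 < n" using assms lt by auto
    show "js ! 0 \<noteq> js ! 1" using dist len assms by (simp add: nth_eq_iff_index_eq)
    show "f (js ! 0) \<le> f (js ! 1)" using mono[of 0 1] assms by simp
  next
    fix j assume "j < n" "j \<noteq> js ! 0"
    then obtain a where "a < n" "js ! a = j" "a \<noteq> 0"
      using set len by (metis in_set_conv_nth lessThan_iff)
    then show "f (js ! 1) \<le> f j" using mono[of 1 a] by simp
  next
    fix c :: real assume c: "0 \<le> c"
    have "sort (map (\<lambda>j. c * f j) [0..<n]) = map (\<lambda>j. c * f j) js"
    proof (rule properties_for_sort)
      show "mset (map (\<lambda>j. c * f j) js) = mset (map (\<lambda>j. c * f j) [0..<n])"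
        by (simp add: js_def)
      show "sorted (map (\<lambda>j. c * f j) js)"
        using srt c by (auto simp: sorted_wrt_iff_nth_less mult_left_mono)
    qed
    then show "sorted_list_of_multiset (mset (map (\<lambda>j. c * f j) [0..<n])) ! 1 = c * f (js ! 1)"
      using assms len by (simp only: sorted_list_of_multiset_mset) simp
  qed
qed

text \<open>The setting in coordinates: \<open>W\<close> is a weighted adjacency matrix and the
  columns of \<open>H\<close> are eigenvectors of its Laplacian. Row orthogonality yields Parseval
  and the spectral formula; column orthogonality normalises and separates the eigenvectors. The
  eigenvalues \<kappa> are complex a priori.\<close>

locale hadamard_Laplacian =
  fixes n :: nat and W :: "nat \<Rightarrow> nat \<Rightarrow> real" and H :: "nat \<Rightarrow> nat \<Rightarrow> complex"
    and \<kappa> :: "nat \<Rightarrow> complex"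
  assumes W_sym: "\<And>i k. i < n \<Longrightarrow> k < n \<Longrightarrow> W i k = W k i"
    and W_nonneg: "\<And>i k. i < n \<Longrightarrow> k < n \<Longrightarrow> 0 \<le> W i k"
    and n_ge_2: "2 \<le> n"
    and rows: "\<And>i l. i < n \<Longrightarrow> l < n \<Longrightarrow> (\<Sum>j<n. H i j * cnj (H l j)) = (if i = l then of_nat n else 0)"
    and cols: "\<And>j l. j < n \<Longrightarrow> l < n \<Longrightarrow> (\<Sum>i<n. cnj (H i j) * H i l) = (if j = l then of_nat n else 0)"
    and unimodular: "\<And>i j. i < n \<Longrightarrow> j < n \<Longrightarrow> cmod (H i j) = 1"
    and eigen: "\<And>i j. i < n \<Longrightarrow> j < n \<Longrightarrow>
      of_real (\<Sum>k<n. W i k) * H i j - (\<Sum>k<n. of_real (W i k) * H k j) = \<kappa> j * H i j"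
begin

section \<open>Eigenvalues and spectral expansion\<close>

definition lam :: "nat \<Rightarrow> real" where "lam j = Re (\<kappa> j)"

text \<open>The columns of \<open>H\<close> have squared norm \<open>n\<close> and are not rescaled,
  hence the factor \<open>n\<close> in the expansions below.\<close>

definition coef :: "(nat \<Rightarrow> real) \<Rightarrow> nat \<Rightarrow> complex" where
  "coef f j = (\<Sum>i<n. cnj (H i j) * of_real (f i))"

text \<open>The Dirichlet form. For 0/1 weights and the indicator function of a set it counts the
  boundary edges of that set.\<close>

definition energy :: "(nat \<Rightarrow> real) \<Rightarrow> real" where
  "energy f = (\<Sum>i<n. \<Sum>k<n. W i k * (f i - f k)\<^sup>2) / 2"

text \<open>Pairing the eigenvalue equation with the column itself, of squared norm
  \<open>n\<close>, gives the Dirichlet form of the column. Hence the eigenvalue is real and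
  nonnegative.\<close>

lemma eigenvalue_form:
  assumes j: "j < n"
  shows "\<kappa> j * of_nat n = of_real ((\<Sum>i<n. \<Sum>k<n. W i k * (cmod (H i j - H k j))\<^sup>2) / 2)"
proof -
  have "\<kappa> j * of_nat n = (\<Sum>i<n. cnj (H i j) * (\<kappa> j * H i j))"
    using cols[OF j j] by (simp add: sum_distrib_left ac_simps flip: sum_distrib_left)
  also have "\<dots> = (\<Sum>i<n. cnj (H i j) * (of_real (\<Sum>k<n. W i k) * H i j - (\<Sum>k<n. of_real (W i k) * H k j)))"
    by (intro sum.cong refl) (simp only: eigen[OF _ j] lessThan_iff)
  finally show ?thesis using sum_Laplacian_form[OF W_sym, where x = "\<lambda>i. H i j"] by simp
qed

lemma
  assumes j: "j < n"
  shows kappa_real: "\<kappa> j = of_real (lam j)" and lam_nonneg: "0 \<le> lam j"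
proof -
  define r where "r = (\<Sum>i<n. \<Sum>k<n. W i k * (cmod (H i j - H k j))\<^sup>2) / 2 / n"
  have k: "\<kappa> j = of_real r"
    using eigenvalue_form[OF j] n_ge_2 by (simp add: r_def field_simps)
  then show "\<kappa> j = of_real (lam j)" by (simp add: lam_def)
  have "0 \<le> r" unfolding r_def
    by (intro divide_nonneg_nonneg sum_nonneg mult_nonneg_nonneg W_nonneg) auto
  then show "0 \<le> lam j" using k by (simp add: lam_def)
qed

text \<open>With \<open>L\<close> for the weighted Laplacian, this is
  \<open>n L = H diag(\<kappa>) H^*\<close> entry by entry: multiply
  \<open>L H = H diag(\<kappa>)\<close> by \<open>H^*\<close> on the right and use the orthogonality
  of the rows.\<close>

lemma spectral_entry:
  assumes "i < n" "l < n"
  shows "of_nat n * (of_real (if i = l then \<Sum>k<n. W i k else 0) - of_real (W i l))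
    = (\<Sum>j<n. \<kappa> j * H i j * cnj (H l j))"
proof -
  have "(\<Sum>j<n. \<kappa> j * H i j * cnj (H l j))
      = (\<Sum>j<n. (of_real (\<Sum>k<n. W i k) * H i j - (\<Sum>k<n. of_real (W i k) * H k j)) * cnj (H l j))"
    by (intro sum.cong refl) (simp only: eigen[OF assms(1)] lessThan_iff)
  also have "\<dots> = of_real (\<Sum>k<n. W i k) * (\<Sum>j<n. H i j * cnj (H l j))
      - (\<Sum>j<n. \<Sum>k<n. of_real (W i k) * (H k j * cnj (H l j)))"
    by (simp only: left_diff_distrib sum_subtractf sum_distrib_left sum_distrib_right mult.assoc)
  also have "(\<Sum>j<n. \<Sum>k<n. of_real (W i k) * (H k j * cnj (H l j)))
      = (\<Sum>k<n. of_real (W i k) * (\<Sum>j<n. H k j * cnj (H l j)))"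
    by (subst sum.swap) (simp add: sum_distrib_left)
  also have "\<dots> = (\<Sum>k<n. of_real (W i k) * (if k = l then of_nat n else 0))"
    using assms by (intro sum.cong refl) (simp only: rows lessThan_iff)
  also have "\<dots> = of_real (W i l) * of_nat n"
    using assms by (simp add: if_distrib cong: if_cong)
  finally show ?thesis using rows[OF assms] by (auto simp: algebra_simps)
qed

text \<open>As \<open>|H i j| = 1\<close>, every diagonal entry of \<open>n L\<close> is the sum of
  all eigenvalues. Without a loop at \<open>i\<close>, this entry is \<open>n\<close> times the
  weighted degree.\<close>

lemma weighted_degree_eq:
  assumes "i < n" "l < n" "W i i = 0" "W l l = 0"
  shows "(\<Sum>k<n. W i k) = (\<Sum>k<n. W l k)"
proof -
  have "of_nat n * complex_of_real (\<Sum>k<n. W i k) = (\<Sum>j<n. \<kappa> j)" if "i < n" "W i i = 0" for i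
  proof -
    have "\<kappa> j * H i j * cnj (H i j) = \<kappa> j" if "j < n" for j
      using unimodular[OF \<open>i < n\<close> that] complex_norm_square[of "H i j"] by (simp add: mult.assoc)
    then have "(\<Sum>j<n. \<kappa> j * H i j * cnj (H i j)) = (\<Sum>j<n. \<kappa> j)"
      by (intro sum.cong refl) simp
    then show ?thesis using spectral_entry[of i i] that by simp
  qed
  from this[of i] this[of l] assms have "of_nat n * complex_of_real (\<Sum>k<n. W i k) = of_nat n * complex_of_real (\<Sum>k<n. W l k)"
    by simp
  then show ?thesis using n_ge_2 by (simp del: of_real_sum)
qed

text \<open>Up to the factor \<open>n\<close>, the adjoint of \<open>H\<close> preserves inner
  products, because the rows of \<open>H\<close> are orthogonal with squared norm
  \<open>n\<close>.\<close>

lemma parseval: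
  "(\<Sum>j<n. coef f j * cnj (coef g j)) = of_real (real n * (\<Sum>i<n. f i * g i))"
proof -
  have "(\<Sum>j<n. coef f j * cnj (coef g j))
      = (\<Sum>j<n. \<Sum>i<n. \<Sum>l<n. of_real (f i * g l) * (H l j * cnj (H i j)))"
    unfolding coef_def cnj_sum sum_product by (intro sum.cong refl) simp
  also have "\<dots> = (\<Sum>i<n. \<Sum>j<n. \<Sum>l<n. of_real (f i * g l) * (H l j * cnj (H i j)))"
    by (rule sum.swap)
  also have "\<dots> = (\<Sum>i<n. \<Sum>l<n. of_real (f i * g l) * (\<Sum>j<n. H l j * cnj (H i j)))"
    by (rule sum.cong[OF refl], subst sum.swap) (simp add: sum_distrib_left)
  also have "\<dots> = (\<Sum>i<n. \<Sum>l<n. of_real (f i * g l) * (if l = i then of_nat n else 0))"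
    by (intro sum.cong refl) (simp only: rows lessThan_iff)
  also have "\<dots> = of_real (real n * (\<Sum>i<n. f i * g i))"
    by (simp add: if_distrib sum_distrib_left ac_simps cong: if_cong)
  finally show ?thesis .
qed

lemma parseval_norm: "(\<Sum>j<n. (cmod (coef f j))\<^sup>2) = real n * (\<Sum>i<n. (f i)\<^sup>2)"
proof -
  have "complex_of_real (\<Sum>j<n. (cmod (coef f j))\<^sup>2) = of_real (real n * (\<Sum>i<n. (f i)\<^sup>2))"
    using parseval[of f f] by (simp only: of_real_sum complex_norm_square power2_eq_square[of "f _"])
  then show ?thesis by (simp only: of_real_eq_iff)
qed

text \<open>Substituting \<open>spectral_entry\<close> into the quadratic form of the Laplacian
  makes it diagonal in the coefficients.\<close>

lemma energy_spectral: "n * energy f = (\<Sum>j<n. lam j * (cmod (coef f j))\<^sup>2)"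
proof -
  let ?L = "\<lambda>i l. of_real (if i = l then \<Sum>k<n. W i k else 0) - complex_of_real (W i l)"
  have "complex_of_real (\<Sum>j<n. lam j * (cmod (coef f j))\<^sup>2)
      = (\<Sum>j<n. \<kappa> j * (cnj (coef f j) * coef f j))"
    by (simp add: kappa_real complex_norm_square mult.commute del: of_real_power)
  also have "\<dots> = (\<Sum>j<n. \<Sum>i<n. \<Sum>l<n. of_real (f i * f l) * (\<kappa> j * H i j * cnj (H l j)))"
    unfolding coef_def cnj_sum sum_product unfolding sum_distrib_left by (intro sum.cong refl) simp
  also have "\<dots> = (\<Sum>i<n. \<Sum>j<n. \<Sum>l<n. of_real (f i * f l) * (\<kappa> j * H i j * cnj (H l j)))"
    by (rule sum.swap)
  also have "\<dots> = (\<Sum>i<n. \<Sum>l<n. of_real (f i * f l) * (\<Sum>j<n. \<kappa> j * H i j * cnj (H l j)))"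
    by (rule sum.cong[OF refl], subst sum.swap) (simp add: sum_distrib_left)
  also have "\<dots> = (\<Sum>i<n. \<Sum>l<n. of_real (f i * f l) * (of_nat n * ?L i l))"
    by (intro sum.cong refl) (simp only: spectral_entry lessThan_iff)
  also have "\<dots> = of_nat n * (\<Sum>i<n. cnj (of_real (f i)) * (\<Sum>l<n. ?L i l * of_real (f l)))"
    by (simp add: sum_distrib_left ac_simps del: of_real_sum)
  also have "\<dots> = of_nat n * (\<Sum>i<n. cnj (of_real (f i)) *
      (of_real (\<Sum>k<n. W i k) * of_real (f i) - (\<Sum>l<n. of_real (W i l) * of_real (f l))))"
  proof (intro arg_cong[of _ _ "(*) (of_nat n)"] sum.cong refl arg_cong[of _ _ "(*) (cnj _)"])
    fix i assume "i \<in> {..<n}"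
    then show "(\<Sum>l<n. ?L i l * of_real (f l)) = of_real (\<Sum>k<n. W i k) * of_real (f i) - (\<Sum>l<n. of_real (W i l) * of_real (f l))"
      by (simp add: left_diff_distrib sum_subtractf if_distrib[of of_real] if_distribR if_distrib[of "\<lambda>x. x * _"]
          del: of_real_sum cong: if_cong)
  qed
  also have "\<dots> = of_real (n * energy f)"
    unfolding energy_def by (subst sum_Laplacian_form[OF W_sym]) (auto simp flip: of_real_diff)
  finally show ?thesis by (simp only: of_real_eq_iff)
qed

text \<open>Constants have energy 0, and the spectral expansion of the energy has nonnegative terms,
  so each term vanishes. This replaces a normalisation of \<open>H\<close> to have an all-ones
  column.\<close>

lemma coef_one_eq_0: "coef (\<lambda>_. 1) j = 0" if "j < n" "lam j > 0"
proof -
  have "(\<Sum>j<n. lam j * (cmod (coef (\<lambda>_. 1) j))\<^sup>2) = 0"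
    using energy_spectral[of "\<lambda>_. 1"] by (simp add: energy_def)
  then have "\<forall>i<n. lam i * (cmod (coef (\<lambda>_. 1) i))\<^sup>2 = 0"
    by (subst (asm) sum_nonneg_eq_0_iff) (auto simp: lam_nonneg)
  then show ?thesis using that by force
qed

lemma energy_eigenvector:
  assumes x: "\<And>i. i < n \<Longrightarrow> (\<Sum>k<n. W i k) * x i - (\<Sum>k<n. W i k * x k) = \<mu> * x i"
  shows "energy x = \<mu> * (\<Sum>i<n. (x i)\<^sup>2)"
proof -
  have "complex_of_real (energy x) = (\<Sum>i<n. cnj (of_real (x i)) *
      (of_real (\<Sum>k<n. W i k) * of_real (x i) - (\<Sum>k<n. of_real (W i k) * of_real (x k))))"
    unfolding energy_def by (subst sum_Laplacian_form[OF W_sym]) (auto simp flip: of_real_diff)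
  also have "\<dots> = of_real (\<Sum>i<n. x i * ((\<Sum>k<n. W i k) * x i - (\<Sum>k<n. W i k * x k)))"
    by simp
  also have "\<dots> = of_real (\<Sum>i<n. x i * (\<mu> * x i))"
    by (intro arg_cong[of _ _ complex_of_real] sum.cong refl) (simp only: x lessThan_iff)
  finally show ?thesis
    by (simp only: of_real_eq_iff) (simp add: sum_distrib_left power2_eq_square ac_simps)
qed

text \<open>The columns of the Laplacian sum to 0, so summing the eigenvalue equation over all
  \<open>i\<close> leaves \<open>\<mu>\<close> times the sum of \<open>x\<close> equal to 0.\<close>

lemma sum_eigenvector:
  assumes x: "\<And>i. i < n \<Longrightarrow> (\<Sum>k<n. W i k) * x i - (\<Sum>k<n. W i k * x k) = \<mu> * x i"
    and "\<mu> \<noteq> 0"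
  shows "(\<Sum>i<n. x i) = 0"
proof -
  have "\<mu> * (\<Sum>i<n. x i) = (\<Sum>i<n. (\<Sum>k<n. W i k) * x i - (\<Sum>k<n. W i k * x k))"
    by (simp add: x sum_distrib_left)
  also have "\<dots> = (\<Sum>i<n. \<Sum>k<n. W i k * x i) - (\<Sum>k<n. \<Sum>i<n. W i k * x k)"
    by (simp add: sum_subtractf sum_distrib_right) (rule sum.swap)
  also have "(\<Sum>k<n. \<Sum>i<n. W i k * x k) = (\<Sum>k<n. \<Sum>i<n. W k i * x k)"
    by (intro sum.cong refl) (simp add: W_sym)
  finally show ?thesis using assms(2) by simp
qed

section \<open>The second smallest eigenvalue and its cuts\<close>

context
  fixes p q
  assumes p: "p < n" and q: "q < n" and pq: "p \<noteq> q" and le: "lam p \<le> lam q"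
    and min: "\<And>j. j < n \<Longrightarrow> j \<noteq> p \<Longrightarrow> lam q \<le> lam j"
begin

text \<open>If all eigenvalues were positive, all coefficients of the constant function would
  vanish, against Parseval.\<close>

lemma lam_smallest: "lam p = 0"
proof (rule ccontr)
  assume "lam p \<noteq> 0"
  then have "0 < lam p" using lam_nonneg[OF p] by simp
  then have "lam j > 0" if "j < n" for j using min[OF that] le that by (cases "j = p") auto
  then have "(\<Sum>j<n. (cmod (coef (\<lambda>_. 1) j))\<^sup>2) = 0" by (simp add: coef_one_eq_0)
  then show False using parseval_norm[of "\<lambda>_. 1"] n_ge_2 by simp
qed

text \<open>Termwise comparison of the two spectral expansions. The index \<open>p\<close> is
  harmless because a positive \<open>lam q\<close> makes column \<open>p\<close> a multiple of the
  constants, to which \<open>f\<close> is orthogonal.\<close>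

lemma rayleigh:
  assumes f: "(\<Sum>i<n. f i) = 0"
  shows "lam q * (\<Sum>i<n. (f i)\<^sup>2) \<le> energy f"
proof -
  have "lam q * (cmod (coef f j))\<^sup>2 \<le> lam j * (cmod (coef f j))\<^sup>2" if j: "j < n" for j
  proof (cases "j = p \<and> lam q > 0")
    case False
    then have "lam q \<le> lam j"
      using min[OF j] lam_nonneg[OF j] by (cases "j = p") auto
    then show ?thesis by (rule mult_right_mono) simp
  next
    case True
    define e where "e = coef (\<lambda>_. 1)"
    have e0: "e i = 0" if "i < n" "i \<noteq> p" for i
      unfolding e_def using that True min[OF that] by (intro coef_one_eq_0) auto
    \<comment> \<open>The constant function has no component off column \<open>p\<close>, so
      Parseval sums involving it reduce to a single term.\<close>
    have only_p: "(\<Sum>i<n. e i * g i) = e p * g p" for g :: "nat \<Rightarrow> complex"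
    proof -
      have "(\<Sum>i<n. e i * g i) = (\<Sum>i<n. if i = p then e p * g p else 0)"
        by (intro sum.cong refl) (auto simp: e0)
      then show ?thesis using p by simp
    qed
    have "e p \<noteq> 0"
      using parseval[of "\<lambda>_. 1" "\<lambda>_. 1"] n_ge_2 by (auto simp flip: e_def simp: only_p)
    moreover have "e p * cnj (coef f p) = 0"
      using parseval[of "\<lambda>_. 1" f] f by (simp flip: e_def add: only_p)
    ultimately show ?thesis using True by simp
  qed
  then have "lam q * (\<Sum>j<n. (cmod (coef f j))\<^sup>2) \<le> n * energy f"
    unfolding energy_spectral sum_distrib_left by (intro sum_mono) auto
  then have "real n * (lam q * (\<Sum>i<n. (f i)\<^sup>2)) \<le> n * energy f"
    by (simp only: parseval_norm mult.left_commute)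
  then show ?thesis using n_ge_2 by simp
qed

text \<open>A constant column lies in the kernel of the Laplacian, so column \<open>q\<close> serves
  if its eigenvalue is nonzero. Otherwise columns \<open>p\<close> and \<open>q\<close> both have
  eigenvalue 0 and, being orthogonal, cannot both be constant.\<close>

lemma nonconstant_column:
  obtains r a b where "r < n" "lam r = lam q" "a < n" "b < n" "H a r \<noteq> H b r"
proof (cases "lam q = 0")
  case False
  have "\<exists>a<n. \<exists>b<n. H a q \<noteq> H b q"
  proof (rule ccontr)
    assume "\<not> ?thesis"
    moreover have n0: "0 < n" using n_ge_2 by simp
    ultimately have c: "H a q = H 0 q" if "a < n" for a using that by blast
    have "(\<Sum>k<n. of_real (W 0 k) * H k q) = of_real (\<Sum>k<n. W 0 k) * H 0 q"
      unfolding of_real_sum sum_distrib_right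
      by (rule sum.cong[OF refl]) (metis c lessThan_iff)
    then have "\<kappa> q * H 0 q = 0"
      using eigen[OF n0 q] by simp
    moreover have "H 0 q \<noteq> 0" using unimodular[OF n0 q] by auto
    ultimately show False using False by (simp add: lam_def)
  qed
  then show ?thesis using that[of q] q by blast
next
  case True
  have "\<exists>r\<in>{p,q}. \<exists>a<n. \<exists>b<n. H a r \<noteq> H b r"
  proof (rule ccontr)
    assume "\<not> ?thesis"
    moreover have n0: "0 < n" using n_ge_2 by simp
    ultimately have c: "H a p = H 0 p" "H a q = H 0 q" if "a < n" for a using that by blast+
    have "(\<Sum>i<n. cnj (H i p) * H i q) = (\<Sum>i<n. cnj (H 0 p) * H 0 q)"
      by (rule sum.cong[OF refl]) (metis c lessThan_iff)
    then have "of_nat n * (cnj (H 0 p) * H 0 q) = 0" using cols[OF p q] pq by simp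
    then show False using unimodular[OF n0 p] unimodular[OF n0 q] n0 by auto
  qed
  then show ?thesis using that p q True lam_smallest by (metis insert_iff singletonD)
qed

text \<open>
  If \<open>h\<close> has entries in \<open>{1, -1, \<i>, -\<i>}\<close>, then \<open>Re h + Im h\<close> and \<open>Re h - Im h\<close> have entries
  \<open>\<plusminus>1\<close>, and at least one of them is not constant unless \<open>h\<close> is.
\<close>

lemma sign_eigenvector:
  assumes turyn: "\<And>i j. i < n \<Longrightarrow> j < n \<Longrightarrow> H i j \<in> {1, -1, \<i>, -\<i>}"
  obtains x :: "nat \<Rightarrow> real" and a b where "\<And>i. i < n \<Longrightarrow> x i \<in> {1, -1}"
    "\<And>i. i < n \<Longrightarrow> (\<Sum>k<n. W i k) * x i - (\<Sum>k<n. W i k * x k) = lam q * x i"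
    "a < n" "b < n" "x a = 1" "x b = -1"
proof -
  obtain r a b where r: "r < n" and eq: "lam r = lam q" and ab: "a < n" "b < n" "H a r \<noteq> H b r"
    by (rule nonconstant_column)
  define x where "x s i = Re (H i r) + s * Im (H i r)" for s i
  have ent: "x s i \<in> {1, -1}" if "i < n" "s \<in> {1, -1}" for s i
    using turyn[OF that(1) r] that(2) by (auto simp: x_def)
  have ev: "(\<Sum>k<n. W i k) * x s i - (\<Sum>k<n. W i k * x s k) = lam q * x s i" if "i < n" for s i
  proof -
    \<comment> \<open>Since \<open>W\<close> and the eigenvalue are real, the real and imaginary
      parts of the column satisfy the eigenvalue equation separately.\<close>
    have "Re (of_real (\<Sum>k<n. W i k) * H i r - (\<Sum>k<n. of_real (W i k) * H k r)) = lam q * Re (H i r)"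
      and "Im (of_real (\<Sum>k<n. W i k) * H i r - (\<Sum>k<n. of_real (W i k) * H k r)) = lam q * Im (H i r)"
      by (simp_all only: eigen[OF that r]) (simp_all add: kappa_real[OF r] eq)
    then show ?thesis
      by (simp add: x_def distrib_left sum.distrib algebra_simps sum_distrib_left flip: of_real_sum)
  qed
  have "\<exists>s\<in>{1, -1}. x s a \<noteq> x s b"
    using turyn[OF ab(1) r] turyn[OF ab(2) r] ab(3) by (auto simp: x_def)
  then obtain s where s: "s \<in> {1, -1}" "x s a \<noteq> x s b" by blast
  with ent[OF ab(1) s(1)] ent[OF ab(2) s(1)]
  consider "x s a = 1" "x s b = -1" | "x s b = 1" "x s a = -1" by auto
  then show ?thesis using that[of "x s"] ent[OF _ s(1)] ev ab by cases blast+
qed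

text \<open>\<open>rayleigh\<close> is applied to the indicator minus its mean \<open>s / n\<close>,
  which has the same energy and squared norm \<open>s (n - s) / n\<close>.\<close>

lemma cut_lower:
  assumes S: "S \<subseteq> {..<n}"
  shows "lam q / 2 * min (card S) (n - card S) \<le> energy (\<lambda>i. of_bool (i \<in> S))"
proof -
  define s where "s = real (card S)"
  define f :: "nat \<Rightarrow> real" where "f i = of_bool (i \<in> S)" for i
  have sn: "card S \<le> n" using card_mono[OF _ S] by simp
  have sum_f: "(\<Sum>i<n. f i) = s"
    using S by (simp add: f_def s_def of_bool_def sum.If_cases inf.absorb2)
  have sq_f: "(f i)\<^sup>2 = f i" for i by (simp add: f_def)
  have "(\<Sum>i<n. (f i - s / n)\<^sup>2) = (\<Sum>i<n. f i - 2 * (s / n) * f i + (s / n)\<^sup>2)"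
    by (intro sum.cong refl) (simp add: power2_diff sq_f)
  also have "\<dots> = s - 2 * (s / n) * s + n * (s / n)\<^sup>2"
    unfolding sum.distrib sum_subtractf sum_distrib_left[symmetric] sum_f by simp
  also have "\<dots> = s * (n - s) / n"
    using n_ge_2 by (simp add: field_simps power2_eq_square)
  finally have sq: "(\<Sum>i<n. (f i - s / n)\<^sup>2) = s * (n - s) / n" .
  have "(\<Sum>i<n. f i - s / n) = 0" using n_ge_2 by (simp add: sum_subtractf sum_f)
  from rayleigh[OF this] have *: "lam q * (s * (n - s) / n) \<le> energy f"
    by (simp add: sq) (simp add: energy_def)
  \<comment> \<open>The larger of \<open>s\<close> and \<open>n - s\<close> is at least
    \<open>n / 2\<close>; this is where the factor 1/2 comes from.\<close>
  have "min s (n - s) * (n / 2) \<le> min s (n - s) * max s (n - s)"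
    using sn by (intro mult_left_mono) (auto simp: s_def max_def)
  also have "\<dots> = s * (n - s)" by (auto simp: min_def max_def)
  finally have "min s (n - s) / 2 \<le> s * (n - s) / n" using n_ge_2 by (simp add: field_simps)
  from order_trans[OF mult_left_mono[OF this lam_nonneg[OF q]] *]
  have "lam q / 2 * min s (n - s) \<le> energy f" by simp
  moreover have "real (min (card S) (n - card S)) = min s (n - s)"
    using sn by (simp add: s_def of_nat_diff of_nat_min)
  ultimately show ?thesis by (simp add: f_def[abs_def])
qed

text \<open>For the sign eigenvector \<open>x = 2 f - 1\<close>, the energy of \<open>x\<close> is
  both \<open>4 * energy f\<close> and \<open>lam q * n\<close>. If \<open>lam q\<close> is nonzero,
  \<open>x\<close> sums to 0, so \<open>S\<close> has \<open>n / 2\<close> elements and equality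
  holds; if it is 0, both sides vanish whatever the size of \<open>S\<close>.\<close>

lemma cut_attained:
  assumes turyn: "\<And>i j. i < n \<Longrightarrow> j < n \<Longrightarrow> H i j \<in> {1, -1, \<i>, -\<i>}"
  obtains S where "S \<subseteq> {..<n}" "S \<noteq> {}" "S \<noteq> {..<n}"
    "energy (\<lambda>i. of_bool (i \<in> S)) = lam q / 2 * min (card S) (n - card S)"
proof -
  obtain x :: "nat \<Rightarrow> real" and a b where x: "\<And>i. i < n \<Longrightarrow> x i \<in> {1, -1}"
    and ev: "\<And>i. i < n \<Longrightarrow> (\<Sum>k<n. W i k) * x i - (\<Sum>k<n. W i k * x k) = lam q * x i"
    and ab: "a < n" "b < n" "x a = 1" "x b = -1"
    using sign_eigenvector[OF turyn] by blast
  define S where "S = {i. i < n \<and> x i = 1}"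
  define f :: "nat \<Rightarrow> real" where "f i = of_bool (i \<in> S)" for i
  have S: "S \<subseteq> {..<n}" by (auto simp: S_def)
  have xf: "x i = 2 * f i - 1" if "i < n" for i
    using x[OF that] that by (auto simp: f_def S_def)
  have "energy x = 4 * energy f"
  proof -
    have "(\<Sum>i<n. \<Sum>k<n. W i k * (x i - x k)\<^sup>2) = (\<Sum>i<n. \<Sum>k<n. 4 * (W i k * (f i - f k)\<^sup>2))"
      by (intro sum.cong refl) (simp add: xf power2_eq_square algebra_simps)
    then show ?thesis by (simp add: energy_def flip: sum_distrib_left)
  qed
  moreover have "(\<Sum>i<n. (x i)\<^sup>2) = (\<Sum>i<n. 1)"
    using x by (intro sum.cong refl) (force simp: power2_eq_1_iff)
  ultimately have e: "4 * energy f = lam q * n"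
    using energy_eigenvector[OF ev] by simp
  have "energy f = lam q / 2 * min (card S) (n - card S)"
  proof (cases "lam q = 0")
    case False
    have "(\<Sum>i<n. x i) = 0" by (rule sum_eigenvector[OF ev False])
    moreover have "(\<Sum>i<n. x i) = 2 * (\<Sum>i<n. f i) - n"
      by (simp add: xf sum_subtractf sum_distrib_left)
    moreover have "(\<Sum>i<n. f i) = card S"
      using S by (simp add: f_def of_bool_def sum.If_cases inf.absorb2)
    ultimately have half: "real n = 2 * card S" by linarith
    then have "min (card S) (n - card S) = card S" by linarith
    then show ?thesis using e by (simp add: half mult.commute)
  qed (use e in simp)
  moreover have "a \<in> S" "b \<notin> S" using ab by (auto simp: S_def)
  ultimately show ?thesis using that[of S] S ab by (auto simp: f_def[abs_def])
qed

end

end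

subsection \<open>Hadamard matrices and characteristic polynomials\<close>

lemma mat_adjoint_index:
  assumes "i < dim_col A" "j < dim_row A"
  shows "mat_adjoint A $$ (i, j) = conjugate (A $$ (j, i))"
  using assms by (simp add: mat_adjoint_def mat_of_rows_index)

text \<open>A right inverse of a square matrix is also a left inverse; hence orthogonality of the
  columns follows from that of the rows.\<close>

lemma
  assumes "complex_hadamard n H"
  shows complex_hadamard_rows: "\<And>i l. i < n \<Longrightarrow> l < n \<Longrightarrow>
      (\<Sum>j<n. H $$ (i, j) * cnj (H $$ (l, j))) = (if i = l then of_nat n else 0)"
    and complex_hadamard_cols: "\<And>j l. j < n \<Longrightarrow> l < n \<Longrightarrow>
      (\<Sum>i<n. cnj (H $$ (i, j)) * H $$ (i, l)) = (if j = l then of_nat n else 0)"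
    and complex_hadamard_inverse: "n > 0 \<Longrightarrow> H * (inverse (of_nat n) \<cdot>\<^sub>m mat_adjoint H) = 1\<^sub>m n"
proof -
  have H: "H \<in> carrier_mat n n" and HH: "H * mat_adjoint H = of_nat n \<cdot>\<^sub>m 1\<^sub>m n"
    using assms by (auto simp: complex_hadamard_def)
  have A: "mat_adjoint H \<in> carrier_mat n n"
    using H by (intro carrier_matI) (simp_all add: mat_adjoint_def)
  show "(\<Sum>j<n. H $$ (i, j) * cnj (H $$ (l, j))) = (if i = l then of_nat n else 0)"
    if "i < n" "l < n" for i l
    using arg_cong[OF HH, of "\<lambda>M. M $$ (i, l)"] that H A
    by (simp add: scalar_prod_def mat_adjoint_index atLeast0LessThan)
  show inv: "H * (inverse (of_nat n) \<cdot>\<^sub>m mat_adjoint H) = 1\<^sub>m n" if "n > 0"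
    using H A HH that by (simp add: mult_smult_distrib) (auto intro!: eq_matI)
  show "(\<Sum>i<n. cnj (H $$ (i, j)) * H $$ (i, l)) = (if j = l then of_nat n else 0)"
    if "j < n" "l < n" for j l
  proof -
    have "(inverse (of_nat n) \<cdot>\<^sub>m mat_adjoint H) * H = 1\<^sub>m n"
      using that by (intro mat_mult_left_right_inverse[OF H _ inv]) (use A in auto)
    from arg_cong[OF this, of "\<lambda>M. M $$ (j, l)"]
    have "inverse (of_nat n) * (\<Sum>i<n. cnj (H $$ (i, j)) * H $$ (i, l)) = (if j = l then 1 else 0)"
      using that H A
      by (simp add: scalar_prod_def mat_adjoint_index atLeast0LessThan sum_distrib_left mult.assoc)
    then show ?thesis using that by (auto simp: field_simps split: if_splits)
  qed
qed

text \<open>Over the complex numbers \<open>A\<close> is similar to a diagonal matrix with real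
  entries, which factors its characteristic polynomial. The factorisation descends to the reals as
  the embedding of polynomials is injective.\<close>

lemma proots_char_poly_diagonalised:
  fixes A :: "real mat" and H B :: "complex mat"
  assumes A: "A \<in> carrier_mat n n" and H: "H \<in> carrier_mat n n" and B: "B \<in> carrier_mat n n"
    and HB: "H * B = 1\<^sub>m n"
    and AH: "map_mat of_real A * H = H * mat_diag n (\<lambda>j. of_real (\<nu> j))"
  shows "proots (char_poly A) = mset (map \<nu> [0..<n])"
proof -
  let ?A = "map_mat complex_of_real A" and ?D = "mat_diag n (\<lambda>j. complex_of_real (\<nu> j))"
  interpret h: map_poly_inj_idom_hom "of_real :: real \<Rightarrow> complex" ..
  have cA: "?A \<in> carrier_mat n n" using A by simp
  have "?A = ?A * (H * B)" using cA HB by simp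
  also have "\<dots> = H * ?D * B" using assoc_mult_mat[OF cA H B] by (simp add: AH)
  finally have "similar_mat ?A ?D"
    using cA H B HB mat_mult_left_right_inverse[OF H B HB] by (intro similar_matI[of _ _ H B n]) auto
  then have "map_poly of_real (char_poly A) = char_poly ?D"
    using char_poly_similar of_real_hom.char_poly_hom[OF A] by metis
  also have "\<dots> = (\<Prod>a\<leftarrow>diag_mat ?D. [:- a, 1:])"
    by (rule char_poly_upper_triangular[of _ n]) (auto simp: mat_diag_def)
  also have "diag_mat ?D = map (\<lambda>j. of_real (\<nu> j)) [0..<n]"
    by (auto simp: diag_mat_def mat_diag_def)
  also have "(\<Prod>a\<leftarrow>map (\<lambda>j. complex_of_real (\<nu> j)) [0..<n]. [:- a, 1:])
      = map_poly of_real (\<Prod>j\<leftarrow>[0..<n]. [:- \<nu> j, 1:])"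
    by (simp add: h.hom_prod_list o_def)
  finally have "char_poly A = (\<Prod>j\<leftarrow>[0..<n]. [:- \<nu> j, 1:])" by simp
  moreover have "proots (\<Prod>j\<leftarrow>js. [:- \<nu> j, 1:]) = mset (map \<nu> js)" for js
  proof (induct js)
    case (Cons j js)
    have "proots ([:- \<nu> j, 1:] * (\<Prod>j\<leftarrow>js. [:- \<nu> j, 1:])) = proots [:- \<nu> j, 1:] + proots (\<Prod>j\<leftarrow>js. [:- \<nu> j, 1:])"
      by (rule proots_mult) (auto simp: prod_list_zero_iff)
    then show ?case using Cons by (simp del: mult_pCons_left)
  qed simp
  ultimately show ?thesis by simp
qed

subsection \<open>Enumerated graphs\<close>

definition arc_weight :: "'v pair_pre_digraph \<Rightarrow> 'v list \<Rightarrow> nat \<Rightarrow> nat \<Rightarrow> real" where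
  "arc_weight G vs i k = of_bool ((vs ! i, vs ! k) \<in> parcs G)"

context
  fixes G :: "'v pair_pre_digraph" and vs :: "'v list" and n :: nat and W :: "nat \<Rightarrow> nat \<Rightarrow> real"
  assumes graph: "pair_graph G" and enum: "vertex_enumeration G vs"
  defines "n \<equiv> length vs"
    and "W \<equiv> arc_weight G vs"
begin

lemma length_enum: "n = card (pverts G)"
  using enum distinct_card[of vs] by (simp add: vertex_enumeration_def n_def)

lemma bij_enum: "bij_betw ((!) vs) {..<n} (pverts G)"
  using enum bij_betw_nth[of vs "{..<n}" "pverts G"] by (simp add: vertex_enumeration_def n_def)

lemma enum_eq_iff: "i < n \<Longrightarrow> k < n \<Longrightarrow> vs ! i = vs ! k \<longleftrightarrow> i = k"
  using enum by (simp add: vertex_enumeration_def n_def nth_eq_iff_index_eq)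

lemma weight_sym: "W i k = W k i"
proof -
  interpret pair_graph G by (rule graph)
  show ?thesis using arcs_symmetric by (auto simp: W_def arc_weight_def)
qed

lemma weight_diag: "W i i = 0"
proof -
  interpret pair_graph G by (rule graph)
  show ?thesis using pair_no_loops[of "(vs ! i, vs ! i)"] by (auto simp: W_def arc_weight_def)
qed

text \<open>Serves for both the arcs leaving a vertex and the edge boundary of a set.\<close>

lemma card_arcs_enum:
  assumes "P \<subseteq> parcs G"
  shows "real (card P) = (\<Sum>i<n. \<Sum>k<n. of_bool ((vs ! i, vs ! k) \<in> P))"
proof -
  interpret pair_graph G by (rule graph)
  have sub: "P \<subseteq> pverts G \<times> pverts G"
    using assms arc_fst_in_verts arc_snd_in_verts by fastforce
  have "real (card P) = (\<Sum>e\<in>pverts G \<times> pverts G. of_bool (e \<in> P))"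
    using sub by (simp add: of_bool_def sum.If_cases inf.absorb2 pair_finite_verts)
  also have "\<dots> = (\<Sum>u\<in>pverts G. \<Sum>v\<in>pverts G. of_bool ((u, v) \<in> P))"
    by (subst sum.cartesian_product) (simp only: case_prod_unfold prod.collapse)
  also have "\<dots> = (\<Sum>i<n. \<Sum>k<n. of_bool ((vs ! i, vs ! k) \<in> P))"
    by (simp flip: sum.reindex_bij_betw[OF bij_enum])
  finally show ?thesis .
qed

lemma degree_enum:
  assumes "i < n"
  shows "real (degree_of G (vs ! i)) = (\<Sum>k<n. W i k)"
proof -
  let ?P = "{e \<in> parcs G. fst e = vs ! i}"
  have "degree_of G (vs ! i) = card ?P"
    by (simp add: degree_of_def out_degree_def out_arcs_def with_proj_def)
  also have "real \<dots> = (\<Sum>j<n. \<Sum>k<n. of_bool ((vs ! j, vs ! k) \<in> ?P))"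
    by (rule card_arcs_enum) auto
  also have "\<dots> = (\<Sum>j<n. if j = i then \<Sum>k<n. W i k else 0)"
    using assms by (intro sum.cong refl) (auto simp: W_def arc_weight_def enum_eq_iff)
  finally show ?thesis using assms by simp
qed

text \<open>The squared difference is 1 exactly on index pairs separated by \<open>S\<close>. By
  symmetry the arcs out of \<open>S\<close> and into \<open>S\<close> contribute equally, hence the
  half. The right-hand side is the energy of the indicator of \<open>S\<close>.\<close>

lemma boundary_enum:
  assumes S: "S \<subseteq> {..<n}"
  shows "real (card (edge_boundary G ((!) vs ` S)))
    = (\<Sum>i<n. \<Sum>k<n. W i k * (of_bool (i \<in> S) - of_bool (k \<in> S))\<^sup>2) / 2"
proof -
  have mem: "vs ! i \<in> (!) vs ` S \<longleftrightarrow> i \<in> S" if "i < n" for i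
    using S that enum_eq_iff by (auto simp: subset_iff image_iff)
  have vert: "vs ! i \<in> pverts G" if "i < n" for i
    using bij_betwE[OF bij_enum] that by auto
  define C where "C = (\<Sum>i<n. \<Sum>k<n. W i k * of_bool (i \<in> S \<and> k \<notin> S))"
  have "real (card (edge_boundary G ((!) vs ` S)))
      = (\<Sum>i<n. \<Sum>k<n. of_bool ((vs ! i, vs ! k) \<in> edge_boundary G ((!) vs ` S)))"
    by (rule card_arcs_enum) (auto simp: edge_boundary_def)
  also have "\<dots> = C" unfolding C_def
    by (intro sum.cong refl) (auto simp: edge_boundary_def W_def arc_weight_def mem vert)
  finally have card: "real (card (edge_boundary G ((!) vs ` S))) = C" .
  have C': "C = (\<Sum>i<n. \<Sum>k<n. W i k * of_bool (k \<in> S \<and> i \<notin> S))"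
    unfolding C_def by (subst sum.swap) (simp add: weight_sym)
  have "(\<Sum>i<n. \<Sum>k<n. W i k * (of_bool (i \<in> S) - of_bool (k \<in> S))\<^sup>2) = C + C"
    by (subst (2) C', unfold C_def, simp only: flip: sum.distrib)
      (intro sum.cong refl, auto)
  then show ?thesis using card by simp
qed

lemma laplacian_enum:
  assumes "i < n" "k < n"
  shows "laplacian_mat G vs $$ (i, k) = (if i = k then \<Sum>l<n. W i l else 0) - W i k"
  using assms degree_enum by (simp add: laplacian_mat_def degree_mat_def adjacency_mat_def W_def arc_weight_def n_def)

lemma laplacian_carrier: "laplacian_mat G vs \<in> carrier_mat n n"
  by (intro carrier_matI) (simp_all add: laplacian_mat_def degree_mat_def adjacency_mat_def n_def)

lemma laplacian_row_times:
  fixes x :: "nat \<Rightarrow> complex"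
  assumes "i < n"
  shows "(\<Sum>k<n. of_real (laplacian_mat G vs $$ (i, k)) * x k)
    = of_real (\<Sum>k<n. W i k) * x i - (\<Sum>k<n. of_real (W i k) * x k)"
proof -
  have "(\<Sum>k<n. of_real (laplacian_mat G vs $$ (i, k)) * x k)
      = (\<Sum>k<n. (if i = k then of_real (\<Sum>l<n. W i l) * x i else 0) - of_real (W i k) * x k)"
    by (intro sum.cong refl) (use assms in \<open>auto simp: laplacian_enum algebra_simps\<close>)
  then show ?thesis using assms by (simp add: sum_subtractf)
qed

end

theorem proposition2p9:
  fixes G :: "'v pair_pre_digraph" and vs :: "'v list" and H :: "complex mat"
  assumes "pair_graph G"
    and "card (pverts G) \<ge> 2"
    and "vertex_enumeration G vs"
    and "real_hadamard (card (pverts G)) H \<or> turyn_hadamard (card (pverts G)) H"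
    and "laplacian_diagonalisable_by G vs H"
  shows "cheeger_constant G = gamma2 G vs / 2"
proof -

  \<comment> \<open>Passage to coordinates and regularity\<close>
  define n where "n = length vs"
  define W :: "nat \<Rightarrow> nat \<Rightarrow> real" where "W = arc_weight G vs"
  note enumerated = assms(1,3)
  note bij = bij_enum[OF enumerated, folded n_def]
  note deg_enum = degree_enum[OF enumerated, folded n_def W_def]
  note bd_enum = boundary_enum[OF enumerated, folded n_def W_def]
  note lap = laplacian_carrier[OF enumerated, folded n_def]
  note lap_times = laplacian_row_times[OF enumerated, folded n_def W_def]
  have n: "card (pverts G) = n" "2 \<le> n"
    using length_enum[OF enumerated] assms(2) by (auto simp: n_def)
  have had: "complex_hadamard n H" and turyn: "\<And>i j. i < n \<Longrightarrow> j < n \<Longrightarrow> H $$ (i, j) \<in> {1, -1, \<i>, -\<i>}"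
    using assms(4) by (auto simp: n real_hadamard_def turyn_hadamard_def)
  have H: "H \<in> carrier_mat n n" using had by (simp add: complex_hadamard_def)
  have "\<forall>j<n. \<exists>k. eigenvector (map_mat complex_of_real (laplacian_mat G vs)) (col H j) k"
    using assms(5) H by (simp add: laplacian_diagonalisable_by_def)
  then obtain \<kappa> where \<kappa>: "\<And>j. j < n \<Longrightarrow>
      eigenvector (map_mat complex_of_real (laplacian_mat G vs)) (col H j) (\<kappa> j)"
    by metis
  have lap_eigen: "(\<Sum>k<n. of_real (laplacian_mat G vs $$ (i, k)) * H $$ (k, j)) = \<kappa> j * H $$ (i, j)"
    if "i < n" "j < n" for i j
  proof -
    have "(map_mat complex_of_real (laplacian_mat G vs) *\<^sub>v col H j) $ i = (\<kappa> j \<cdot>\<^sub>v col H j) $ i"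
      using \<kappa>[OF that(2)] by (simp add: eigenvector_def)
    then show ?thesis
      using that H lap by (simp add: scalar_prod_def atLeast0LessThan)
  qed
  interpret hadamard_Laplacian n W "\<lambda>i j. H $$ (i, j)" \<kappa>
  proof
    show "W i k = W k i" for i k
      using weight_sym[OF enumerated] by (simp add: W_def)
    show "of_real (\<Sum>k<n. W i k) * H $$ (i, j) - (\<Sum>k<n. of_real (W i k) * H $$ (k, j)) = \<kappa> j * H $$ (i, j)"
      if "i < n" "j < n" for i j
      using lap_times[of i "\<lambda>k. H $$ (k, j)"] lap_eigen that by simp
    show "cmod (H $$ (i, j)) = 1" if "i < n" "j < n" for i j
      using had that by (simp add: complex_hadamard_def)
  qed (use n complex_hadamard_rows[OF had] complex_hadamard_cols[OF had] in \<open>auto simp: W_def arc_weight_def\<close>)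
  define d where "d = degree_of G (vs ! 0)"
  have deg_i: "degree_of G (vs ! i) = d" if "i < n" for i
  proof -
    have "W k k = 0" for k
      using weight_diag[OF enumerated] by (simp add: W_def)
    then have "(\<Sum>k<n. W i k) = (\<Sum>k<n. W 0 k)"
      using that n(2) by (intro weighted_degree_eq) auto
    then have "real (degree_of G (vs ! i)) = real d"
      using deg_enum[OF that] deg_enum[of 0] n(2) by (simp add: d_def)
    then show ?thesis by simp
  qed
  have deg: "degree_of G u = d" if "u \<in> pverts G" for u
    using that deg_i unfolding bij_betw_imp_surj_on[OF bij, symmetric] by auto
  obtain p q where p: "p < n" and q: "q < n" and pq: "p \<noteq> q" "lam p \<le> lam q"
    "\<And>j. j < n \<Longrightarrow> j \<noteq> p \<Longrightarrow> lam q \<le> lam j"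
    and sorted: "\<And>c. 0 \<le> c \<Longrightarrow> sorted_list_of_multiset (mset (map (\<lambda>j. c * lam j) [0..<n])) ! 1 = c * lam q"
    using second_smallest[OF n(2)] by blast
  note idx = p q pq

  \<comment> \<open>Spectrum of the normalised Laplacian\<close>
  let ?N = "normalised_laplacian_mat G vs"
  have N: "?N \<in> carrier_mat n n"
    by (simp add: normalised_laplacian_mat_def n_def)
  \<comment> \<open>All degrees equal \<open>d\<close>, so the two square roots multiply to
    \<open>d\<close>. If \<open>d = 0\<close>, both sides are 0 because
    \<open>x / 0 = 0\<close>.\<close>
  have N_entry: "?N $$ (i, k) = 1 / d * laplacian_mat G vs $$ (i, k)" if "i < n" "k < n" for i k
    using that by (simp add: normalised_laplacian_mat_def deg_i flip: n_def)
  have "map_mat complex_of_real ?N * H = H * mat_diag n (\<lambda>j. of_real (1 / d * lam j))"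
  proof (rule eq_matI)
    fix i j assume "i < dim_row (H * mat_diag n (\<lambda>j. complex_of_real (1 / d * lam j)))"
      "j < dim_col (H * mat_diag n (\<lambda>j. complex_of_real (1 / d * lam j)))"
    then have ij: "i < n" "j < n" using H by (auto simp: mat_diag_def)
    have "(map_mat complex_of_real ?N * H) $$ (i, j) = (\<Sum>k<n. of_real (?N $$ (i, k)) * H $$ (k, j))"
      using ij H N by (simp add: scalar_prod_def atLeast0LessThan)
    also have "\<dots> = of_real (1 / d) * (\<Sum>k<n. of_real (laplacian_mat G vs $$ (i, k)) * H $$ (k, j))"
      unfolding sum_distrib_left by (intro sum.cong refl) (simp add: N_entry ij(1))
    also have "\<dots> = H $$ (i, j) * of_real (1 / d * lam j)"
      by (simp add: lap_eigen ij kappa_real)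
    finally show "(map_mat complex_of_real ?N * H) $$ (i, j)
        = (H * mat_diag n (\<lambda>j. complex_of_real (1 / d * lam j))) $$ (i, j)"
      using ij by (simp add: mat_diag_mult_right[OF H])
  qed (use H N in \<open>auto simp: mat_diag_def\<close>)
  moreover have "inverse (of_nat n) \<cdot>\<^sub>m mat_adjoint H \<in> carrier_mat n n"
    using H by (intro carrier_matI) (simp_all add: mat_adjoint_def)
  ultimately have "proots (char_poly ?N) = mset (map (\<lambda>j. 1 / d * lam j) [0..<n])"
    using proots_char_poly_diagonalised[OF N H] complex_hadamard_inverse[OF had] n by simp
  then have gamma2: "gamma2 G vs = 1 / d * lam q"
    unfolding gamma2_def sorted_eigenvalues_def using sorted[of "1 / d"] by simp

  \<comment> \<open>Cheeger ratios in terms of energies\<close>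
  have fin: "finite (pverts G)"
    using bij_betw_finite[OF bij] by simp
  define E where "E S = energy (\<lambda>i. of_bool (i \<in> S))" for S
  \<comment> \<open>By regularity the volumes are \<open>d\<close> times the cardinalities.\<close>
  have ratio: "cheeger_ratio G ((!) vs ` S) = E S / (d * min (card S) (n - card S))"
    if S: "S \<subseteq> {..<n}" for S
  proof -
    have img: "(!) vs ` S \<subseteq> pverts G"
      using image_mono[OF S] bij_betw_imp_surj_on[OF bij] by metis
    have card: "card ((!) vs ` S) = card S"
      by (rule card_image[OF inj_on_subset[OF bij_betw_imp_inj_on[OF bij] S]])
    have "(\<Sum>x\<in>(!) vs ` S. degree_of G x) = (\<Sum>x\<in>(!) vs ` S. d)"
      using img by (intro sum.cong refl deg) auto
    moreover have "(\<Sum>y\<in>pverts G - (!) vs ` S. degree_of G y) = (\<Sum>y\<in>pverts G - (!) vs ` S. d)"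
      by (intro sum.cong refl deg) auto
    moreover have "card (pverts G - (!) vs ` S) = n - card S"
      using card_Diff_subset[OF finite_subset[OF img fin] img] by (simp only: card n(1))
    ultimately have "min (\<Sum>x\<in>(!) vs ` S. degree_of G x) (\<Sum>y\<in>pverts G - (!) vs ` S. degree_of G y)
        = d * min (card S) (n - card S)"
      by (simp add: card mult.commute nat_mult_min_right)
    then show ?thesis
      by (simp only: cheeger_ratio_def bd_enum[OF S] E_def energy_def)
  qed
  have proper: "0 < min (card S) (n - card S)" if "S \<subseteq> {..<n}" "S \<noteq> {}" "S \<noteq> {..<n}" for S
  proof -
    have "card S < n" using psubset_card_mono[of "{..<n}" S] that by auto
    moreover have "0 < card S" using that finite_subset[OF that(1)] by (simp add: card_gt_0_iff)
    ultimately show ?thesis by simp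
  qed

  \<comment> \<open>The lower bound and a minimising set\<close>
  have lower: "gamma2 G vs / 2 \<le> cheeger_ratio G T" if T: "T \<subset> pverts G" "T \<noteq> {}" for T
  proof -
    define S where "S = {i. i < n \<and> vs ! i \<in> T}"
    have TS: "T = (!) vs ` S"
      using T(1) unfolding bij_betw_imp_surj_on[OF bij, symmetric] by (auto simp: S_def)
    have "S \<subseteq> {..<n}" by (auto simp: S_def)
    moreover have "S \<noteq> {}" using T(2) TS by blast
    moreover have "S \<noteq> {..<n}" using T(1) TS bij_betw_imp_surj_on[OF bij] by blast
    ultimately have S: "S \<subseteq> {..<n}" "S \<noteq> {}" "S \<noteq> {..<n}" .
    \<comment> \<open>The minimum is nonzero and cancels; for \<open>d = 0\<close> both sides are 0
      by the convention on division.\<close>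
    have "gamma2 G vs / 2 = lam q / 2 * min (card S) (n - card S) / (d * min (card S) (n - card S))"
      using proper[OF S] by (auto simp: gamma2 min_def)
    also have "\<dots> \<le> E S / (d * min (card S) (n - card S))"
      unfolding E_def using cut_lower[OF idx S(1)] by (intro divide_right_mono) auto
    finally show ?thesis by (simp add: TS ratio[OF S(1)])
  qed
  obtain S where S: "S \<subseteq> {..<n}" "S \<noteq> {}" "S \<noteq> {..<n}"
    and ES: "E S = lam q / 2 * min (card S) (n - card S)"
    unfolding E_def using cut_attained[OF idx turyn] by blast
  have attained: "cheeger_ratio G ((!) vs ` S) = gamma2 G vs / 2"
    using proper[OF S] by (auto simp: ratio[OF S(1)] ES gamma2 min_def)
  have "(!) vs ` S \<noteq> pverts G"
    using inj_on_image_eq_iff[OF bij_betw_imp_inj_on[OF bij] S(1) order_refl] S(3)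
      bij_betw_imp_surj_on[OF bij] by metis
  moreover have "(!) vs ` S \<subseteq> pverts G"
    using image_mono[OF S(1)] bij_betw_imp_surj_on[OF bij] by metis
  moreover have "(!) vs ` S \<noteq> {}" using S(2) by simp
  ultimately have "cheeger_ratio G ((!) vs ` S) \<in> cheeger_ratio G ` {S. S \<subset> pverts G \<and> S \<noteq> {}}"
    by blast
  moreover have "finite {S. S \<subset> pverts G \<and> S \<noteq> {}}"
    by (rule finite_subset[of _ "Pow (pverts G)"]) (use fin in auto)
  ultimately show ?thesis
    unfolding cheeger_constant_def attained using lower by (intro Min_eqI) blast+
qed

end
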